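(* Let $\mathfrak{h}$ and $\mathfrak{g}$ be finite-dimensional real Lie algebras and let $\rho:\mathfrak{h}\to\mathfrak{g}$ be a Lie algebra homomorphism. If the induced map $$H^1(\rho^* ): H^1(\mathfrak{g},\mathfrak{g})\to H^1(\mathfrak{h},\mathfrak{g})$$ is surjective, then $\rho$ is rigid with respect to the action of $\mathrm{Aut}(\mathfrak{g})$. That is, every Lie algebra homomorphism $\rho':\mathfrak{h}\to\mathfrak{g}$ sufficiently close to $\rho$ in $\mathrm{Hom}(\mathfrak{h},\mathfrak{g})$ is of the form $\rho'=A\circ\rho$ for some $A\in\mathrm{Aut}(\mathfrak{g})$ close to the identity.
   Context: For a Lie algebra $\mathfrak{k}$ and a representation $r:\mathfrak{k}\to\mathfrak{gl}(V)$, the Chevalley–Eilenberg complex has cochains $C^k(\mathfrak{k},V)=\mathrm{Hom}(\wedge^k\mathfrak{k},V)$ and differential $$\delta\omega(u_0,\ldots,u_k)=\sum_{i}(-1)^i r(u_i)\,\omega(u_0,\ldots,\widehat{u_i},\ldots,u_k)+\sum_{i<j}(-1)^{i+j}\omega([u_i,u_j],u_0,\ldots,\widehat{u_i},\ldots,\widehat{u_j},\ldots,u_k).$$ $H^k(\mathfrak{g},\mathfrak{g})$ is the cohomology of $\mathfrak{g}$ with coefficients in its adjoint representation. $H^k(\mathfrak{h},\mathfrak{g})$ is the cohomology of $\mathfrak{h}$ with coefficients in $\mathfrak{g}$, viewed as a representation of $\mathfrak{h}$ via $r=\mathrm{ad}_{\mathfrak{g}}\circ\rho$. The chain map $\rho^*:\mathrm{Hom}(\wedge^k\mathfrak{g},\mathfrak{g})\to\mathrm{Hom}(\wedge^k\mathfrak{h},\mathfrak{g})$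 is $(\rho^*\omega)(v_1,\ldots,v_k)=\omega(\rho(v_1),\ldots,\rho(v_k))$, and $H^1(\rho^* )$ is the map it induces in degree-one cohomology. $\mathrm{Aut}(\mathfrak{g})\subset\mathrm{GL}(\mathfrak{g})$ is the group of all Lie algebra automorphisms of $\mathfrak{g}$, acting on homomorphisms $\mathfrak{h}\to\mathfrak{g}$ by post-composition. The "close" formulation means: for every neighborhood $V$ of the identity in $\mathrm{Aut}(\mathfrak{g})$ there is a neighborhood $U$ of $\rho$ in $\mathrm{Hom}(\mathfrak{h},\mathfrak{g})$ such that every Lie algebra homomorphism $\rho'\in U$ equals $A\circ\rho$ for some $A\in V$. *)

theory Defs
  imports "HOL-Analysis.Analysis"
begin

section \<open>Lie algebras and homomorphisms\<close>

locale real_lie_algebra =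
  fixes bracket :: "'a::real_vector \<Rightarrow> 'a \<Rightarrow> 'a"
  assumes bilinear: "bilinear bracket"
    and bracket_self: "bracket x x = 0"
    and jacobi: "bracket x (bracket y z) + bracket y (bracket z x) + bracket z (bracket x y) = 0"

locale fin_dim_real_lie_algebra = real_lie_algebra bracket
  for bracket :: "'a::real_vector \<Rightarrow> 'a \<Rightarrow> 'a" +
  assumes fin_dim: "\<exists>B::'a set. finite B \<and> span B = UNIV"

definition lie_hom ::
    "('a::real_vector \<Rightarrow> 'a \<Rightarrow> 'a) \<Rightarrow> ('b::real_vector \<Rightarrow> 'b \<Rightarrow> 'b) \<Rightarrow> ('a \<Rightarrow> 'b) \<Rightarrow> bool"
  where "lie_hom brA brB f \<longleftrightarrow> linear f \<and> (\<forall>x y. f (brA x y) = brB (f x) (f y))"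

definition ad :: "('a \<Rightarrow> 'a \<Rightarrow> 'a) \<Rightarrow> 'a \<Rightarrow> 'a \<Rightarrow> 'a"
  where "ad br x = (\<lambda>y. br x y)"


section \<open>Chevalley--Eilenberg cohomology\<close>

text \<open>
  A \<open>k\<close>-cochain, i.e. an element of \<open>Hom(\<Lambda>\<^sup>k \<kk>, V)\<close>, is an alternating \<open>k\<close>-linear map.  Its
  argument tuple is a list of length \<open>k\<close>; the value on lists of any other length is fixed
  to be \<open>0\<close>, so that cochains are equal as functions iff they are equal as multilinear maps.
\<close>

definition cochains :: "nat \<Rightarrow> ('a::real_vector list \<Rightarrow> 'v::real_vector) set"
  where "cochains k = {\<omega>.
     (\<forall>us. length us \<noteq> k \<longrightarrow> \<omega> us = 0) \<and>
     (\<forall>us i. length us = k \<and> i < k \<longrightarrow> linear (\<lambda>u. \<omega> (us[i := u]))) \<and>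
     (\<forall>us i j. length us = k \<and> i < j \<and> j < k \<and> us ! i = us ! j \<longrightarrow> \<omega> us = 0)}"

text \<open>
  \<open>nths us (- {i})\<close> is \<open>us\<close> with the entry at position \<open>i\<close> omitted.  The degree of \<open>\<omega>\<close> need
  not be passed: it is one less than the length of the argument list wherever \<open>\<omega>\<close> can
  contribute.
\<close>

definition ce_diff ::
    "('a \<Rightarrow> 'a \<Rightarrow> 'a) \<Rightarrow> ('a \<Rightarrow> 'v \<Rightarrow> 'v) \<Rightarrow> ('a list \<Rightarrow> 'v) \<Rightarrow> 'a list \<Rightarrow> 'v::real_vector"
  where "ce_diff br r \<omega> us =
     (\<Sum>i<length us. (-1) ^ i *\<^sub>R r (us ! i) (\<omega> (nths us (- {i})))) +
     (\<Sum>j<length us. \<Sum>i<j. (-1) ^ (i + j) *\<^sub>R \<omega> (br (us ! i) (us ! j) # nths us (- {i, j})))"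

definition cocycles ::
    "('a \<Rightarrow> 'a \<Rightarrow> 'a) \<Rightarrow> ('a \<Rightarrow> 'v \<Rightarrow> 'v) \<Rightarrow> nat \<Rightarrow> ('a::real_vector list \<Rightarrow> 'v::real_vector) set"
  where "cocycles br r k = {\<omega> \<in> cochains k. ce_diff br r \<omega> = (\<lambda>_. 0)}"

definition coboundaries ::
    "('a \<Rightarrow> 'a \<Rightarrow> 'a) \<Rightarrow> ('a \<Rightarrow> 'v \<Rightarrow> 'v) \<Rightarrow> nat \<Rightarrow> ('a::real_vector list \<Rightarrow> 'v::real_vector) set"
  where "coboundaries br r k =
     (case k of 0 \<Rightarrow> {\<lambda>_. 0} | Suc m \<Rightarrow> ce_diff br r ` cochains m)"

definition cohomologous ::
    "('a \<Rightarrow> 'a \<Rightarrow> 'a) \<Rightarrow> ('a \<Rightarrow> 'v \<Rightarrow> 'v) \<Rightarrow> nat \<Rightarrow>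
     (('a::real_vector list \<Rightarrow> 'v::real_vector) \<times> ('a list \<Rightarrow> 'v)) set"
  where "cohomologous br r k =
     {(\<omega>, \<eta>). \<omega> \<in> cocycles br r k \<and> \<eta> \<in> cocycles br r k \<and>
             (\<lambda>us. \<omega> us - \<eta> us) \<in> coboundaries br r k}"

definition cohomology ::
    "('a \<Rightarrow> 'a \<Rightarrow> 'a) \<Rightarrow> ('a \<Rightarrow> 'v \<Rightarrow> 'v) \<Rightarrow> nat \<Rightarrow>
     ('a::real_vector list \<Rightarrow> 'v::real_vector) set set"
  where "cohomology br r k = cocycles br r k // cohomologous br r k"

definition pullback :: "('b \<Rightarrow> 'a) \<Rightarrow> ('a list \<Rightarrow> 'v) \<Rightarrow> 'b list \<Rightarrow> 'v"
  where "pullback \<rho> \<omega> = (\<lambda>vs. \<omega> (map \<rho> vs))"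

text \<open>
  The map induced by \<open>\<rho>\<^sup>*\<close> from the cohomology of \<open>\<gg>\<close> with coefficients in the
  representation \<open>r\<close> to that of \<open>\<hh>\<close> with coefficients in \<open>r \<circ> \<rho>\<close>.  A class is sent to the
  class of the pullback of its representatives; see \<open>cohomology_map_class\<close> below.
\<close>

definition cohomology_map ::
    "('h \<Rightarrow> 'h \<Rightarrow> 'h) \<Rightarrow> ('g \<Rightarrow> 'v \<Rightarrow> 'v) \<Rightarrow> nat \<Rightarrow> ('h \<Rightarrow> 'g) \<Rightarrow>
     ('g list \<Rightarrow> 'v) set \<Rightarrow> ('h::real_vector list \<Rightarrow> 'v::real_vector) set"
  where "cohomology_map brh r k \<rho> c = cohomologous brh (r \<circ> \<rho>) k `` (pullback \<rho> ` c)"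

lemma pullback_cochain:
  assumes "linear \<rho>" "\<omega> \<in> cochains k"
  shows "pullback \<rho> \<omega> \<in> cochains k"
proof -
  have "linear (\<lambda>u. \<omega> (map \<rho> (us[i := u])))" if "length us = k" "i < k" for us i
  proof -
    have "linear (\<lambda>u. \<omega> ((map \<rho> us)[i := u]))"
      using assms(2) that by (auto simp: cochains_def)
    from linear_compose[OF assms(1) this] show ?thesis
      by (simp add: o_def map_update)
  qed
  moreover have "\<omega> (map \<rho> us) = 0"
    if "length us = k" "i < j" "j < k" "us ! i = us ! j" for us i j
  proof -
    have "length (map \<rho> us) = k \<and> i < j \<and> j < k \<and> map \<rho> us ! i = map \<rho> us ! j"
      using that by simp
    then show ?thesis
      using assms(2) unfolding cochains_def by blast
  qed
  ultimately show ?thesis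
    using assms(2) by (auto simp: cochains_def pullback_def)
qed

lemma pullback_ce_diff:
  assumes "lie_hom brh brg \<rho>"
  shows "ce_diff brh (r \<circ> \<rho>) (pullback \<rho> \<omega>) = pullback \<rho> (ce_diff brg r \<omega>)"
  using assms
  by (auto simp: fun_eq_iff ce_diff_def pullback_def lie_hom_def nths_map
           intro!: arg_cong2[where f = "(+)"] sum.cong)

lemma pullback_cocycle:
  assumes "lie_hom brh brg \<rho>" "\<omega> \<in> cocycles brg r k"
  shows "pullback \<rho> \<omega> \<in> cocycles brh (r \<circ> \<rho>) k"
  using assms pullback_cochain[of \<rho> \<omega> k]
  by (auto simp: cocycles_def pullback_ce_diff[OF assms(1)] lie_hom_def) (auto simp: pullback_def)

lemma pullback_coboundary:
  assumes "lie_hom brh brg \<rho>" "\<omega> \<in> coboundaries brg r k"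
  shows "pullback \<rho> \<omega> \<in> coboundaries brh (r \<circ> \<rho>) k"
proof (cases k)
  case 0
  then show ?thesis using assms by (auto simp: coboundaries_def pullback_def)
next
  case (Suc m)
  then obtain \<eta> where \<eta>: "\<eta> \<in> cochains m" "\<omega> = ce_diff brg r \<eta>"
    using assms by (auto simp: coboundaries_def)
  then have "pullback \<rho> \<omega> = ce_diff brh (r \<circ> \<rho>) (pullback \<rho> \<eta>)"
    using pullback_ce_diff[OF assms(1)] by metis
  with \<eta> Suc pullback_cochain[of \<rho> \<eta> m] assms(1) show ?thesis
    by (auto simp: coboundaries_def lie_hom_def)
qed

lemma pullback_cohomologous:
  assumes "lie_hom brh brg \<rho>" "(\<omega>, \<eta>) \<in> cohomologous brg r k"
  shows "(pullback \<rho> \<omega>, pullback \<rho> \<eta>) \<in> cohomologous brh (r \<circ> \<rho>) k"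
  using assms pullback_coboundary[OF assms(1), of "\<lambda>us. \<omega> us - \<eta> us" r k]
  by (auto simp: cohomologous_def pullback_cocycle[OF assms(1)]) (simp add: pullback_def)

lemma cochains_diff:
  assumes "\<omega> \<in> cochains k" "\<eta> \<in> cochains k"
  shows "(\<lambda>us. \<omega> us - \<eta> us) \<in> cochains k"
  using assms by (auto simp: cochains_def intro!: linear_compose_sub)

lemma zero_cochain: "(\<lambda>_. 0) \<in> cochains k"
  by (auto simp: cochains_def linear_zero)

lemma ce_diff_diff:
  assumes "\<And>x. linear (r x)"
  shows "ce_diff br r (\<lambda>us. \<omega> us - \<eta> us) = (\<lambda>us. ce_diff br r \<omega> us - ce_diff br r \<eta> us)"
  using assms
  by (auto simp: fun_eq_iff ce_diff_def linear_diff scaleR_diff_right sum_subtractf)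

lemma coboundaries_zero:
  assumes "\<And>x. linear (r x)"
  shows "(\<lambda>_. 0) \<in> coboundaries br r k"
proof -
  have "ce_diff br r (\<lambda>_. 0) = (\<lambda>_. 0)"
    using ce_diff_diff[of r br "\<lambda>_. 0" "\<lambda>_. 0", OF assms] by simp
  then show ?thesis
    by (auto simp: coboundaries_def split: nat.split intro!: image_eqI[OF _ zero_cochain])
qed

lemma coboundaries_diff:
  assumes "\<And>x. linear (r x)" "\<omega> \<in> coboundaries br r k" "\<eta> \<in> coboundaries br r k"
  shows "(\<lambda>us. \<omega> us - \<eta> us) \<in> coboundaries br r k"
  using assms(2,3)
  by (auto simp: coboundaries_def ce_diff_diff[of r br, OF assms(1), symmetric]
           split: nat.splits intro!: imageI cochains_diff)

lemma equiv_cohomologous: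
  assumes "\<And>x. linear (r x)"
  shows "equiv (cocycles br r k) (cohomologous br r k)"
proof (rule equivI)
  have *: "(\<lambda>us. \<eta> us - \<omega> us) \<in> coboundaries br r k"
    if "(\<lambda>us. \<omega> us - \<eta> us) \<in> coboundaries br r k" for \<omega> \<eta>
    using coboundaries_diff[of r, OF assms coboundaries_zero[of r, OF assms] that] by simp
  have "(\<lambda>us. \<omega> us - \<theta> us) \<in> coboundaries br r k"
    if "(\<lambda>us. \<omega> us - \<eta> us) \<in> coboundaries br r k" "(\<lambda>us. \<eta> us - \<theta> us) \<in> coboundaries br r k"
    for \<omega> \<eta> \<theta>
    using coboundaries_diff[of r, OF assms that(1) *[OF that(2)]] by simp
  then show "trans (cohomologous br r k)"
    by (auto simp: cohomologous_def trans_def)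
  show "sym (cohomologous br r k)"
    using * by (auto simp: cohomologous_def sym_def)
  show "refl_on (cocycles br r k) (cohomologous br r k)"
    using coboundaries_zero[of r, OF assms] by (auto simp: cohomologous_def refl_on_def)
  show "cohomologous br r k \<subseteq> cocycles br r k \<times> cocycles br r k"
    by (auto simp: cohomologous_def)
qed

lemma cohomology_map_class:
  assumes r: "\<And>x. linear (r x)" and \<rho>: "lie_hom brh brg \<rho>" and \<omega>: "\<omega> \<in> cocycles brg r k"
  shows "cohomology_map brh r k \<rho> (cohomologous brg r k `` {\<omega>}) =
           cohomologous brh (r \<circ> \<rho>) k `` {pullback \<rho> \<omega>}"
proof -
  have "equiv (cocycles brg r k) (cohomologous brg r k)"
    by (rule equiv_cohomologous) (rule r)
  then have in_class: "\<omega> \<in> cohomologous brg r k `` {\<omega>}"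
    using \<omega> by (rule equiv_class_self)
  have eq: "equiv (cocycles brh (r \<circ> \<rho>) k) (cohomologous brh (r \<circ> \<rho>) k)"
    by (rule equiv_cohomologous) (simp add: r)
  have "cohomologous brh (r \<circ> \<rho>) k `` {pullback \<rho> \<eta>} =
          cohomologous brh (r \<circ> \<rho>) k `` {pullback \<rho> \<omega>}"
    if "(\<omega>, \<eta>) \<in> cohomologous brg r k" for \<eta>
    using equiv_class_eq[OF eq pullback_cohomologous[OF \<rho> that]] by simp
  with in_class show ?thesis
    unfolding cohomology_map_def by blast
qed


section \<open>Rigidity\<close>

text \<open>
  On finite-dimensional normed spaces every linear map is bounded, so the type \<open>'a \<Rightarrow>\<^sub>L 'b\<close> consists
  of all linear maps; it carries the operator norm, which induces the canonical topology.
\<close>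

definition Lie_Hom ::
    "('a::real_normed_vector \<Rightarrow> 'a \<Rightarrow> 'a) \<Rightarrow> ('b::real_normed_vector \<Rightarrow> 'b \<Rightarrow> 'b) \<Rightarrow> ('a \<Rightarrow>\<^sub>L 'b) set"
  where "Lie_Hom brA brB = {f. lie_hom brA brB (blinfun_apply f)}"

definition Lie_Aut :: "('a::real_normed_vector \<Rightarrow> 'a \<Rightarrow> 'a) \<Rightarrow> ('a \<Rightarrow>\<^sub>L 'a) set"
  where "Lie_Aut br = {A \<in> Lie_Hom br br. bij (blinfun_apply A)}"

definition rigid_wrt_Aut ::
    "('h::real_normed_vector \<Rightarrow> 'h \<Rightarrow> 'h) \<Rightarrow> ('g::real_normed_vector \<Rightarrow> 'g \<Rightarrow> 'g) \<Rightarrow>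
     ('h \<Rightarrow>\<^sub>L 'g) \<Rightarrow> bool"
  where "rigid_wrt_Aut brh brg \<rho> \<longleftrightarrow>
     (\<forall>V. openin (top_of_set (Lie_Aut brg)) V \<and> id_blinfun \<in> V \<longrightarrow>
       (\<exists>U. openin (top_of_set (Lie_Hom brh brg)) U \<and> \<rho> \<in> U \<and>
         (\<forall>\<rho>'\<in>U. \<exists>A\<in>V. \<rho>' = A o\<^sub>L \<rho>)))"

end

theory Submission
  imports Defs
begin

text \<open>
  Surjectivity on \<open>H\<^sup>1\<close> says that every \<open>1\<close>-cocycle of \<open>\<hh>\<close> along \<open>\<rho>\<close> has the form \<open>E \<circ> \<rho>\<close> with \<open>E\<close> a
  derivation of \<open>\<gg>\<close>.  If \<open>\<phi> = \<rho> + d\<close> is a homomorphism near \<open>\<rho>\<close>, then \<open>d\<close> is a cocycle up to an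
  error of order \<open>\<parallel>d\<parallel>\<^sup>2\<close>, so an automorphism \<open>P\<close> close to \<open>1 - E\<close> for a suitable derivation \<open>E\<close>
  satisfies \<open>P \<circ> \<phi> = \<rho> + O(\<parallel>d\<parallel>\<^sup>2)\<close>.  This quadratic improvement, together with compactness of bounded
  closed sets of automorphisms, yields an automorphism \<open>A\<close> near \<open>1\<close> with \<open>A \<circ> \<phi> = \<rho>\<close>.
\<close>

section \<open>Finite-dimensional normed spaces\<close>

text \<open>Some ball of radius \<open>e\<close> around \<open>b\<close> misses the closed span;
  rescaling by \<open>k\<close> carries this over to multiples of \<open>b\<close>. The bound
  controls the coefficient of the new vector in the inductions over spanning sets.\<close>

lemma span_insert_coeff_bound:
  fixes b :: "'a::real_normed_vector"
  assumes "closed (span S)" "b \<notin> span S"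
  obtains e where "e > 0" "\<And>k s. s \<in> span S \<Longrightarrow> \<bar>k\<bar> * e \<le> norm (k *\<^sub>R b + s)"
proof -
  have "open (- span S)" "b \<in> - span S"
    using assms by auto
  then obtain e where e: "e > 0" "ball b e \<subseteq> - span S"
    by (meson openE)
  show thesis
  proof (rule that[OF e(1)])
    fix k s assume s: "s \<in> span S"
    show "\<bar>k\<bar> * e \<le> norm (k *\<^sub>R b + s)"
    proof (cases "k = 0")
      case False
      have "(-1 / k) *\<^sub>R s \<notin> ball b e"
        using e(2) span_scale[OF s] by blast
      then have "e \<le> norm (b + (1 / k) *\<^sub>R s)"
        by (simp add: dist_norm)
      then have "\<bar>k\<bar> * e \<le> norm (k *\<^sub>R (b + (1 / k) *\<^sub>R s))"
        by (simp add: mult_left_mono)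
      with False show ?thesis
        by (simp add: scaleR_add_right)
    qed simp
  qed
qed

text \<open>A convergent sequence is bounded, so it lies in a single compact piece, which then
  contains the limit.\<close>

lemma closed_if_compact_Int_cball:
  fixes S :: "'a::real_normed_vector set"
  assumes "\<And>r. compact (S \<inter> cball 0 r)"
  shows "closed S"
  unfolding closed_sequential_limits
proof (intro allI impI, elim conjE)
  fix x l assume x: "\<forall>n. x n \<in> S" "x \<longlonglongrightarrow> l"
  from x(2) have "bounded (range x)"
    by (rule convergent_imp_bounded)
  then obtain r where "\<And>n. norm (x n) \<le> r"
    by (auto simp: bounded_iff)
  with x(1) have "\<And>n. x n \<in> S \<inter> cball 0 r"
    by simp
  from closed_sequentially[OF compact_imp_closed[OF assms] this x(2)] show "l \<in> S"
    by simp
qed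

text \<open>Heine-Borel by induction over the spanning set: the new ball is a closed part of the
  image of an interval times a ball in the old span. The radius is generalised because removing the
  \<open>b\<close>-component may increase the norm.\<close>

lemma compact_span_Int_cball:
  fixes B :: "'a::real_normed_vector set"
  assumes "finite B"
  shows "compact (span B \<inter> cball 0 r)"
  using assms
proof (induction B arbitrary: r rule: finite_induct)
  case empty
  show ?case by (cases "r \<ge> 0") (auto simp: Int_insert_left)
next
  case (insert b S)
  show ?case
  proof (cases "b \<in> span S")
    case True
    then show ?thesis using insert.IH by (simp add: span_redundant)
  next
    case False
    have "closed (span S)"
      using insert.IH by (rule closed_if_compact_Int_cball)
    then obtain e where e: "e > 0" "\<And>k s. s \<in> span S \<Longrightarrow> \<bar>k\<bar> * e \<le> norm (k *\<^sub>R b + s)"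
      using False span_insert_coeff_bound by blast
    \<comment> \<open>The coefficient bound forces \<bar>k\<bar> \<le> \<open>r / e\<close>, so the
      remaining summand has norm at most \<open>r + r / e * norm b\<close>; hence \<open>P\<close>
      holds coordinates for the whole ball.\<close>
    define P where "P = cball (0::real) (r / e) \<times> (span S \<inter> cball 0 (r + r / e * norm b))"
    define f where "f = (\<lambda>(k, s). k *\<^sub>R b + s)"
    have "compact P"
      unfolding P_def by (intro compact_Times insert.IH compact_cball)
    moreover have "continuous_on P f"
      unfolding f_def case_prod_beta by (intro continuous_intros)
    ultimately have "compact (f ` P \<inter> cball 0 r)"
      by (intro compact_Int_closed compact_continuous_image) auto
    moreover have "f ` P \<inter> cball 0 r = span (insert b S) \<inter> cball 0 r"
    proof (intro equalityI subsetI)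
      fix x assume "x \<in> f ` P \<inter> cball 0 r"
      then obtain k s where ks: "x = k *\<^sub>R b + s" "s \<in> span S" "norm x \<le> r"
        by (auto simp: P_def f_def)
      then have "x - k *\<^sub>R b \<in> span S"
        by simp
      with ks(3) show "x \<in> span (insert b S) \<inter> cball 0 r"
        by (auto simp: span_breakdown_eq)
    next
      fix x assume "x \<in> span (insert b S) \<inter> cball 0 r"
      then obtain k where k: "x - k *\<^sub>R b \<in> span S" "norm x \<le> r"
        by (auto simp: span_breakdown_eq)
      have "\<bar>k\<bar> * e \<le> norm x"
        using e(2)[OF k(1), of k] by simp
      with k e have ke: "\<bar>k\<bar> \<le> r / e"
        by (simp add: pos_le_divide_eq)
      have "norm (x - k *\<^sub>R b) \<le> norm x + \<bar>k\<bar> * norm b"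
        using norm_triangle_ineq4[of x "k *\<^sub>R b"] by simp
      also have "\<dots> \<le> r + r / e * norm b"
        using k ke by (intro add_mono mult_right_mono) auto
      finally have "(k, x - k *\<^sub>R b) \<in> P"
        using k ke by (simp add: P_def)
      moreover have "x = f (k, x - k *\<^sub>R b)"
        by (simp add: f_def)
      ultimately show "x \<in> f ` P \<inter> cball 0 r"
        using k(2) by (auto intro: image_eqI)
    qed
    ultimately show ?thesis by simp
  qed
qed

lemma closed_span_finite:
  fixes B :: "'a::real_normed_vector set"
  assumes "finite B"
  shows "closed (span B)"
  using compact_span_Int_cball[OF assms] by (rule closed_if_compact_Int_cball)

text \<open>The bound is restricted to a span so that it also covers the right inverse in
  \<open>linear_bounded_lift\<close>, whose domain need not be finite-dimensional. In the induction,
  the coefficient of the split-off vector is at most \<open>norm x / e\<close>.\<close>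

lemma linear_bounded_on_span:
  fixes f :: "'a::real_normed_vector \<Rightarrow> 'b::real_normed_vector"
  assumes "linear f" "finite B"
  obtains K where "K \<ge> 0" "\<And>x. x \<in> span B \<Longrightarrow> norm (f x) \<le> K * norm x"
proof -
  have "\<exists>K\<ge>0. \<forall>x\<in>span B. norm (f x) \<le> K * norm x"
    using assms(2)
  proof (induction B rule: finite_induct)
    case empty
    show ?case using assms(1) by (auto simp: linear_0)
  next
    case (insert b S)
    then obtain K where K: "K \<ge> 0" "\<And>x. x \<in> span S \<Longrightarrow> norm (f x) \<le> K * norm x"
      by auto
    show ?case
    proof (cases "b \<in> span S")
      case True
      then show ?thesis using K by (auto simp: span_redundant)
    next
      case False
      then obtain e where e: "e > 0" "\<And>k s. s \<in> span S \<Longrightarrow> \<bar>k\<bar> * e \<le> norm (k *\<^sub>R b + s)"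
        using span_insert_coeff_bound closed_span_finite insert.hyps(1) by metis
      have "norm (f x) \<le> (norm (f b) / e + K * (1 + norm b / e)) * norm x"
        if x: "x \<in> span (insert b S)" for x
      proof -
        obtain k where k: "x - k *\<^sub>R b \<in> span S"
          using x by (auto simp: span_breakdown_eq)
        have "\<bar>k\<bar> * e \<le> norm x"
          using e(2)[OF k, of k] by simp
        with e have ke: "\<bar>k\<bar> \<le> norm x / e"
          by (simp add: pos_le_divide_eq)
        have "f x = k *\<^sub>R f b + f (x - k *\<^sub>R b)"
          using assms(1) by (simp add: linear_diff linear_scale)
        then have "norm (f x) \<le> \<bar>k\<bar> * norm (f b) + norm (f (x - k *\<^sub>R b))"
          using norm_triangle_ineq[of "k *\<^sub>R f b" "f (x - k *\<^sub>R b)"] by simp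
        also have "\<dots> \<le> \<bar>k\<bar> * norm (f b) + K * (norm x + \<bar>k\<bar> * norm b)"
          using norm_triangle_ineq4[of x "k *\<^sub>R b"] order_trans[OF K(2)[OF k]] K(1)
          by (intro add_left_mono) (simp add: mult_left_mono)
        also have "\<dots> \<le> norm x / e * norm (f b) + K * (norm x + norm x / e * norm b)"
          using K(1) ke by (intro add_mono mult_left_mono mult_right_mono) auto
        finally show ?thesis
          by (simp add: algebra_simps)
      qed
      moreover have "0 \<le> norm (f b) / e + K * (1 + norm b / e)"
        using K e by simp
      ultimately show ?thesis by blast
    qed
  qed
  with that show thesis by blast
qed

lemma linear_imp_bounded_linear:
  fixes f :: "'a::real_normed_vector \<Rightarrow> 'b::real_normed_vector" and B :: "'a set"
  assumes "linear f" "finite B" "span B = UNIV"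
  shows "bounded_linear f"
proof -
  obtain K where "\<And>x. x \<in> span B \<Longrightarrow> norm (f x) \<le> K * norm x"
    using linear_bounded_on_span[OF assms(1,2)] by blast
  then show ?thesis
    using assms(1,3) by (intro bounded_linear_intro[of f K])
      (auto simp: mult.commute linear_add linear_scale)
qed

text \<open>A linear right inverse of \<open>T\<close> over the image of \<open>S\<close> is bounded
  there, since that image lies in a finite span. Solutions of a linear equation can thus be replaced
  by solutions of controlled size.\<close>

lemma linear_bounded_lift:
  fixes T :: "'a::real_normed_vector \<Rightarrow> 'b::real_normed_vector"
  assumes "linear T" "finite B" "S \<subseteq> span B" "subspace S"
  obtains K where "K \<ge> 0"
    "\<And>v. v \<in> S \<Longrightarrow> \<exists>v'\<in>S. T v' = T v \<and> norm v' \<le> K * norm (T v)"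
proof -
  obtain g where g: "range g \<subseteq> S" "linear g" "\<And>v. v \<in> T ` S \<Longrightarrow> T (g v) = v"
    using real_vector.linear_exists_right_inverse_on[OF assms(1,4)] by blast
  obtain K where K: "K \<ge> 0" "\<And>x. x \<in> span (T ` B) \<Longrightarrow> norm (g x) \<le> K * norm x"
    using linear_bounded_on_span[OF g(2) finite_imageI[OF assms(2), of T]] by metis
  have T: "T v \<in> span (T ` B)" if "v \<in> S" for v
    using that assms(3) linear_span_image[OF assms(1), of B] by blast
  show thesis
  proof (rule that[OF K(1)])
    fix v assume "v \<in> S"
    then show "\<exists>v'\<in>S. T v' = T v \<and> norm v' \<le> K * norm (T v)"
      using g(1,3) K(2)[OF T] by (intro bexI[of _ "g (T v)"]) auto
  qed
qed

section \<open>Operator spaces and bilinear maps in finite dimension\<close>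

lemma finite_span_blinfun:
  fixes B :: "'a::real_normed_vector set" and C :: "'b::real_normed_vector set"
  assumes "finite B" "span B = UNIV" "finite C" "span C = UNIV"
  obtains D :: "('a \<Rightarrow>\<^sub>L 'b) set" where "finite D" "span D = UNIV"
proof -
  obtain I where I: "I \<subseteq> B" "independent I" "B \<subseteq> span I"
    by (rule real_vector.maximal_independent_subset)
  have sI: "span I = UNIV" and fI: "finite I"
    using I assms span_minimal[OF I(3)] finite_subset by auto
  define c where "c b = Blinfun (\<lambda>x. representation I x b)" for b
  have c: "blinfun_apply (c b) x = representation I x b" for b x
  proof -
    have "linear (\<lambda>x. representation I x b)"
      using real_vector.linear_representation[OF I(2) sI, of b]
      by (simp add: linear_def real_scaleR_def[abs_def])
    then show ?thesis
      unfolding c_def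
      by (subst bounded_linear_Blinfun_apply[OF linear_imp_bounded_linear[OF _ fI sI]]) auto
  qed
  \<comment> \<open>Rank-one operators built from the coordinate functionals \<open>c b\<close>;
    with \<open>v\<close> running through \<open>C\<close> they play the role of matrix
    units.\<close>
  define e where "e b v = blinfun_scaleR_left v o\<^sub>L c b" for b and v :: 'b
  have le: "linear (e b)" for b
    unfolding e_def by (intro linearI blinfun_eqI) (simp_all add: blinfun.bilinear_simps algebra_simps)
  have "f \<in> span (\<Union>b\<in>I. e b ` C)" for f
  proof -
    have "f = (\<Sum>b\<in>I. e b (f b))"
    proof (rule blinfun_eqI)
      fix x
      have "f x = f (\<Sum>b\<in>I. representation I x b *\<^sub>R b)"
        using I fI sI by (subst real_vector.sum_representation_eq) auto
      then show "f x = (\<Sum>b\<in>I. e b (f b)) x"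
        by (simp add: blinfun.bilinear_simps e_def c)
    qed
    moreover have "e b (f b) \<in> span (\<Union>b\<in>I. e b ` C)" if "b \<in> I" for b
    proof -
      have "e b (f b) \<in> span (e b ` C)"
        using assms(4) le[of b] by (auto simp: linear_span_image)
      then show ?thesis
        using that span_mono[of "e b ` C" "\<Union>b\<in>I. e b ` C"] by blast
    qed
    ultimately show ?thesis
      by (metis (no_types, lifting) span_sum)
  qed
  with that[of "\<Union>b\<in>I. e b ` C"] fI assms show thesis
    by blast
qed

text \<open>Currying, with automatic boundedness used once in each argument. It gives brackets an
  operator norm and makes them continuous.\<close>

lemma bilinear_blinfunE:
  fixes \<beta> :: "'a::real_normed_vector \<Rightarrow> 'b::real_normed_vector \<Rightarrow> 'c::real_normed_vector"
    and B :: "'a set" and C :: "'b set"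
  assumes "bilinear \<beta>" "finite B" "span B = UNIV" "finite C" "span C = UNIV"
  obtains b :: "'a \<Rightarrow>\<^sub>L 'b \<Rightarrow>\<^sub>L 'c" where "\<And>x y. b x y = \<beta> x y"
proof -
  have 1: "blinfun_apply (Blinfun (\<beta> x)) = \<beta> x" for x
    using assms by (intro bounded_linear_Blinfun_apply linear_imp_bounded_linear[of _ C])
      (auto simp: bilinear_def)
  have "linear (\<lambda>x. Blinfun (\<beta> x))"
    by (intro linearI blinfun_eqI)
      (simp_all add: 1 blinfun.bilinear_simps bilinear_ladd[OF assms(1)] bilinear_lmul[OF assms(1)])
  then have "blinfun_apply (Blinfun (\<lambda>x. Blinfun (\<beta> x))) = (\<lambda>x. Blinfun (\<beta> x))"
    using assms by (intro bounded_linear_Blinfun_apply linear_imp_bounded_linear[of _ B])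
  with 1 show thesis
    by (intro that[of "Blinfun (\<lambda>x. Blinfun (\<beta> x))"]) simp
qed

section \<open>Operators close to the identity\<close>

lemma near_id_lower_bound:
  fixes A :: "'g::real_normed_vector \<Rightarrow>\<^sub>L 'g"
  assumes "norm (A - id_blinfun) \<le> 1/2"
  shows "norm x \<le> 2 * norm (A x)"
proof -
  have "norm (A x - x) \<le> 1/2 * norm x"
    using norm_blinfun[of "A - id_blinfun" x] mult_right_mono[OF assms, of "norm x"]
    by (simp add: blinfun.bilinear_simps)
  moreover have "norm x \<le> norm (A x) + norm (A x - x)"
    by (metis norm_minus_commute norm_triangle_sub)
  ultimately show ?thesis by simp
qed

text \<open>The image of a basis is independent of the same size; a vector outside its span would
  give an independent set larger than the basis.\<close>

lemma linear_inj_imp_surj_finite_span: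
  fixes f :: "'a::real_vector \<Rightarrow> 'a" and B :: "'a set"
  assumes "linear f" "inj f" "finite B" "span B = UNIV"
  shows "surj f"
proof -
  obtain I where I: "I \<subseteq> B" "independent I" "B \<subseteq> span I"
    by (rule real_vector.maximal_independent_subset)
  have sI: "span I = UNIV" and fI: "finite I"
    using I assms span_minimal[OF I(3)] finite_subset by auto
  have ind: "independent (f ` I)"
    using assms(1) I(2) inj_on_subset[OF assms(2) subset_UNIV]
    by (rule linear_independent_injective_image)
  have card: "card (f ` I) = card I"
    using inj_on_subset[OF assms(2) subset_UNIV] by (rule card_image)
  have "span (f ` I) = UNIV"
  proof (rule ccontr)
    assume "span (f ` I) \<noteq> UNIV"
    then obtain v where v: "v \<notin> span (f ` I)" by auto
    then have "independent (insert v (f ` I))"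
      using ind by (simp add: independent_insertI)
    then have "card (insert v (f ` I)) \<le> card I"
      using real_vector.independent_span_bound[OF fI, of "insert v (f ` I)"] by (simp add: sI)
    moreover have "v \<notin> f ` I"
      using v span_base[of v "f ` I"] by auto
    ultimately show False
      using card fI by simp
  qed
  then show ?thesis
    using linear_span_image[OF assms(1), of I] sI by simp
qed

lemma near_id_inverse:
  fixes A :: "'g::real_normed_vector \<Rightarrow>\<^sub>L 'g" and B :: "'g set"
  assumes "finite B" "span B = UNIV" and A: "norm (A - id_blinfun) \<le> 1/2"
  obtains A' where "A' o\<^sub>L A = id_blinfun" "A o\<^sub>L A' = id_blinfun"
    "norm (A' - id_blinfun) \<le> 2 * norm (A - id_blinfun)"
proof -
  have lin: "linear (blinfun_apply A)"
    by (intro linearI) (simp_all add: blinfun.bilinear_simps)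
  have inj: "inj (blinfun_apply A)"
    unfolding linear_injective_0[OF lin]
  proof (intro allI impI)
    fix x assume "A x = 0"
    then show "x = 0" using near_id_lower_bound[OF A, of x] by simp
  qed
  have surj: "surj (blinfun_apply A)"
    using lin inj assms(1,2) by (rule linear_inj_imp_surj_finite_span)
  have AA: "A (inv A y) = y" for y
    using surj by (rule surj_f_inv_f)
  have A'A: "inv A (A x) = x" for x
    using inj by (rule inv_f_f)
  have "linear (inv A)"
  proof (intro linearI)
    show "inv A (x + y) = inv A x + inv A y" for x y
      using A'A[of "inv A x + inv A y"] by (simp add: blinfun.bilinear_simps AA)
    show "inv A (c *\<^sub>R x) = c *\<^sub>R inv A x" for c x
      using A'A[of "c *\<^sub>R inv A x"] by (simp add: blinfun.bilinear_simps AA)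
  qed
  then have inv: "blinfun_apply (Blinfun (inv A)) = inv A"
    using assms(1,2) by (intro bounded_linear_Blinfun_apply linear_imp_bounded_linear)
  show thesis
  proof (rule that[of "Blinfun (inv A)"])
    show "Blinfun (inv A) o\<^sub>L A = id_blinfun" "A o\<^sub>L Blinfun (inv A) = id_blinfun"
      by (auto intro!: blinfun_eqI simp: inv AA A'A)
    show "norm (Blinfun (inv A) - id_blinfun) \<le> 2 * norm (A - id_blinfun)"
    proof (rule norm_blinfun_bound)
      fix y
      \<comment> \<open>Substituting \<open>y = A (inv A y)\<close> turns the distance of the
        inverse from the identity into that of \<open>A\<close>, evaluated at
        \<open>inv A y\<close>, whose norm is at most \<open>2 * norm y\<close>.\<close>
      have "norm ((Blinfun (inv A) - id_blinfun) y) = norm ((A - id_blinfun) (inv A y))"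
        by (simp add: blinfun.bilinear_simps inv AA norm_minus_commute)
      also have "\<dots> \<le> norm (A - id_blinfun) * norm (inv A y)"
        by (rule norm_blinfun)
      also have "\<dots> \<le> norm (A - id_blinfun) * (2 * norm y)"
        using near_id_lower_bound[OF A, of "inv A y"] by (intro mult_left_mono) (auto simp: AA)
      finally show "norm ((Blinfun (inv A) - id_blinfun) y) \<le> 2 * norm (A - id_blinfun) * norm y"
        by simp
    qed simp
  qed
qed

section \<open>Derivations and automorphisms\<close>

primrec blinfun_pow :: "'a::real_normed_vector \<Rightarrow>\<^sub>L 'a \<Rightarrow> nat \<Rightarrow> 'a \<Rightarrow>\<^sub>L 'a" where
  "blinfun_pow C 0 = id_blinfun"
| "blinfun_pow C (Suc n) = C o\<^sub>L blinfun_pow C n"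

lemma norm_blinfun_pow_le: "norm (blinfun_pow C n) \<le> norm C ^ n"
proof (induction n)
  case (Suc n)
  then show ?case
    using norm_blinfun_compose[of C "blinfun_pow C n"]
    by simp (meson mult_left_mono norm_ge_zero order_trans)
qed (simp add: norm_blinfun_id_le)

context
  fixes E :: "'g::real_normed_vector \<Rightarrow>\<^sub>L 'g" and s :: real and C
  assumes s: "s \<ge> 0"
  defines "C \<equiv> id_blinfun + s *\<^sub>R E"
begin

lemma norm_id_plus_le: "norm C \<le> 1 + s * norm E"
  using norm_triangle_ineq[of id_blinfun "s *\<^sub>R E"] norm_blinfun_id_le[where 'a = 'g] s
  by (simp add: C_def)

lemma norm_pow_id_plus_le: "norm (blinfun_pow C n) \<le> (1 + s * norm E) ^ n"
  using norm_blinfun_pow_le[of C n] power_mono[OF norm_id_plus_le, of n] by simp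

text \<open>Majorant argument: the right-hand side is the same expression with the number
  \<open>norm E\<close> in place of \<open>E\<close>, and it satisfies the recursion of the
  induction step with equality.\<close>

lemma pow_id_plus_first_order:
  "norm (blinfun_pow C n - id_blinfun - (real n * s) *\<^sub>R E)
     \<le> (1 + s * norm E) ^ n - 1 - real n * s * norm E"
proof (induction n)
  case (Suc n)
  let ?X = "blinfun_pow C n - id_blinfun - (real n * s) *\<^sub>R E"
  have "blinfun_pow C (Suc n) - id_blinfun - (real (Suc n) * s) *\<^sub>R E
      = (C o\<^sub>L ?X) + (real n * s * s) *\<^sub>R (E o\<^sub>L E)"
    by (rule blinfun_eqI) (simp add: C_def blinfun.bilinear_simps algebra_simps)
  also have "norm \<dots> \<le> norm C * norm ?X + (real n * s * s) * (norm E * norm E)"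
    using s by (intro norm_triangle_mono norm_blinfun_compose)
      (simp add: mult_left_mono norm_blinfun_compose)
  also have "\<dots> \<le> (1 + s * norm E) * ((1 + s * norm E) ^ n - 1 - real n * s * norm E)
      + (real n * s * s) * (norm E * norm E)"
    using Suc.IH norm_id_plus_le s by (intro add_right_mono mult_mono) auto
  also have "\<dots> = (1 + s * norm E) ^ Suc n - 1 - real (Suc n) * s * norm E"
    by (simp add: algebra_simps)
  finally show ?case .
qed simp

text \<open>For a derivation the terms of order \<open>s\<close> cancel, so one factor
  \<open>1 + s E\<close> violates multiplicativity only by \<open>s\<^sup>2\<close> times the
  bracket of \<open>E x\<close> and \<open>E y\<close>. Over \<open>n\<close> factors these defects
  add up, amplified by the growth of the powers; for \<open>s = 1 / n\<close> the total is of order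
  \<open>1 / n\<close>.\<close>

lemma pow_id_plus_bracket_defect:
  fixes b :: "'g \<Rightarrow>\<^sub>L 'g \<Rightarrow>\<^sub>L 'g"
  assumes der: "\<And>x y. E (b x y) = b (E x) y + b x (E y)"
  shows "norm (blinfun_pow C n (b x y) - b (blinfun_pow C n x) (blinfun_pow C n y))
     \<le> real n * (s\<^sup>2 * (norm b * (norm E)\<^sup>2 * norm x * norm y)) * (1 + s * norm E) ^ (2 * n)"
proof (induction n)
  case (Suc n)
  define q where "q = 1 + s * norm E"
  have q: "q \<ge> 1" using s by (simp add: q_def)
  let ?D = "blinfun_pow C n (b x y) - b (blinfun_pow C n x) (blinfun_pow C n y)"
  let ?u = "blinfun_pow C n x" and ?v = "blinfun_pow C n y"
  let ?K = "s\<^sup>2 * (norm b * (norm E)\<^sup>2 * norm x * norm y)"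
  have uv: "norm ?u \<le> q ^ n * norm x" "norm ?v \<le> q ^ n * norm y"
    using order_trans[OF norm_blinfun mult_right_mono[OF norm_pow_id_plus_le[of n]]] by (auto simp: q_def)
  \<comment> \<open>The old defect transported by \<open>C\<close>, plus the fresh second-order
    defect of the last factor.\<close>
  have "blinfun_pow C (Suc n) (b x y) - b (blinfun_pow C (Suc n) x) (blinfun_pow C (Suc n) y)
      = C ?D - s\<^sup>2 *\<^sub>R b (E ?u) (E ?v)"
    by (simp add: C_def blinfun.bilinear_simps der algebra_simps power2_eq_square)
  also have "norm \<dots> \<le> norm (C ?D) + s\<^sup>2 * norm (b (E ?u) (E ?v))"
    using norm_triangle_ineq4[of "C ?D" "s\<^sup>2 *\<^sub>R b (E ?u) (E ?v)"] by simp
  also have "norm (C ?D) \<le> q * (real n * ?K * q ^ (2 * n))"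
    using Suc.IH norm_id_plus_le q
    by (intro order_trans[OF norm_blinfun mult_mono]) (simp_all add: q_def)
  also have "norm (b (E ?u) (E ?v)) \<le> norm b * (norm E * (q ^ n * norm x)) * (norm E * (q ^ n * norm y))"
  proof -
    have Eu: "norm (E ?u) \<le> norm E * (q ^ n * norm x)" "norm (E ?v) \<le> norm E * (q ^ n * norm y)"
      using order_trans[OF norm_blinfun mult_left_mono[OF uv(1)]]
        order_trans[OF norm_blinfun mult_left_mono[OF uv(2)]] by auto
    have "norm (b (E ?u)) \<le> norm b * (norm E * (q ^ n * norm x))"
      using order_trans[OF norm_blinfun mult_left_mono[OF Eu(1)]] by auto
    then show ?thesis
      by (rule order_trans[OF norm_blinfun mult_mono]) (use Eu(2) q in auto)
  qed
  finally have "norm (blinfun_pow C (Suc n) (b x y) - b (blinfun_pow C (Suc n) x) (blinfun_pow C (Suc n) y))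
      \<le> q * (real n * ?K * q ^ (2 * n))
       + s\<^sup>2 * (norm b * (norm E * (q ^ n * norm x)) * (norm E * (q ^ n * norm y)))"
    by (simp add: mult_left_mono)
  also have "\<dots> = q ^ (2 * n) * ?K * (q * real n + 1)"
  proof -
    have "q ^ (2 * n) = q ^ n * q ^ n"
      by (simp add: mult_2 power_add)
    then show ?thesis
      by (simp add: algebra_simps power2_eq_square)
  qed
  also have "\<dots> \<le> q ^ (2 * n) * ?K * (real (Suc n) * q\<^sup>2)"
  proof (intro mult_left_mono)
    have "q * real n \<le> q\<^sup>2 * real n" "1 \<le> q\<^sup>2"
      using q by (auto simp: power2_eq_square mult_right_mono intro: mult_left_mono[of 1 q q, simplified]
          order_trans[of 1 q])
    then show "q * real n + 1 \<le> real (Suc n) * q\<^sup>2"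
      by (simp add: algebra_simps)
  qed (use q s in auto)
  also have "\<dots> = real (Suc n) * ?K * q ^ (2 * Suc n)"
    by (simp add: power2_eq_square mult.commute mult.left_commute)
  finally show ?case by (simp add: q_def)
qed simp

end

text \<open>
  The compound interest products \<open>(1 + E/n)\<^sup>n\<close> respect the bracket up to \<open>O(1/n)\<close>, so every limit
  point of them is a homomorphism.
\<close>

lemma derivation_approx_hom:
  fixes b :: "'g::real_normed_vector \<Rightarrow>\<^sub>L 'g \<Rightarrow>\<^sub>L 'g" and E :: "'g \<Rightarrow>\<^sub>L 'g" and B :: "'g set"
  assumes fin: "finite B" "span B = UNIV"
    and der: "\<And>x y. E (b x y) = b (E x) y + b x (E y)"
    and E1: "norm E \<le> 1"
  obtains P :: "'g \<Rightarrow>\<^sub>L 'g" where "\<And>x y. P (b x y) = b (P x) (P y)"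
    "norm (P - id_blinfun - E) \<le> (norm E)\<^sup>2"
proof -
  \<comment> \<open>Euler's approximations of the exponential of \<open>E\<close>;
    \<open>Suc n\<close> avoids division by zero.\<close>
  define Q where "Q n = blinfun_pow (id_blinfun + (1 / real (Suc n)) *\<^sub>R E) (Suc n)" for n
  have exp: "(1 + 1 / real (Suc n) * norm E) ^ Suc n \<le> exp (norm E)" for n
  proof -
    have "- real (Suc n) \<le> norm E"
      using norm_ge_zero[of E] by linarith
    then show ?thesis
      using exp_ge_one_plus_x_over_n_power_n[of "Suc n" "norm E"] by simp
  qed
  have first: "norm (Q n - id_blinfun - E) \<le> (norm E)\<^sup>2" for n
  proof -
    have "norm (Q n - id_blinfun - E) \<le> (1 + 1 / real (Suc n) * norm E) ^ Suc n - 1 - norm E"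
      using pow_id_plus_first_order[of "1 / real (Suc n)" E "Suc n"] by (simp add: Q_def)
    also have "\<dots> \<le> exp (norm E) - 1 - norm E"
      using exp[of n] by simp
    also have "\<dots> \<le> (norm E)\<^sup>2"
      using exp_bound[of "norm E"] E1 by simp
    finally show ?thesis .
  qed
  have defect: "norm (Q n (b x y) - b (Q n x) (Q n y))
      \<le> norm b * (norm E)\<^sup>2 * norm x * norm y * (exp (norm E))\<^sup>2 * (1 / real (Suc n))" for n x y
  proof -
    let ?N = "real (Suc n)" and ?M = "norm b * (norm E)\<^sup>2 * norm x * norm y"
    have "norm (Q n (b x y) - b (Q n x) (Q n y))
        \<le> ?N * ((1 / ?N)\<^sup>2 * ?M) * (1 + 1 / ?N * norm E) ^ (2 * Suc n)"
      unfolding Q_def by (rule pow_id_plus_bracket_defect) (auto simp: der)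
    also have "(1 + 1 / ?N * norm E) ^ (2 * Suc n) = ((1 + 1 / ?N * norm E) ^ Suc n)\<^sup>2"
      by (metis mult.commute power_mult)
    also have "?N * ((1 / ?N)\<^sup>2 * ?M) * \<dots> \<le> ?N * ((1 / ?N)\<^sup>2 * ?M) * (exp (norm E))\<^sup>2"
      by (intro mult_left_mono power_mono exp) auto
    also have "?N * ((1 / ?N)\<^sup>2 * ?M) = ?M * (1 / ?N)"
      by (simp add: power2_eq_square field_simps del: of_nat_Suc)
    finally show ?thesis by (simp only: mult_ac)
  qed
  obtain D :: "('g \<Rightarrow>\<^sub>L 'g) set" where D: "finite D" "span D = UNIV"
    by (rule finite_span_blinfun[OF fin fin])
  \<comment> \<open>Boundedness in a finite-dimensional operator space yields a convergent
    subsequence; its limit inherits the estimate \<open>first\<close>, and its bracket defect is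
    zero by \<open>defect\<close>.\<close>
  have "norm (Q n) \<le> 3" for n
  proof -
    have "norm (Q n) \<le> norm (Q n - id_blinfun - E) + norm (id_blinfun :: 'g \<Rightarrow>\<^sub>L 'g) + norm E"
      by (smt (verit) norm_triangle_sub)
    also have "\<dots> \<le> 1 + 1 + 1"
      using first[of n] E1 norm_blinfun_id_le[where 'a = 'g] power_le_one[of "norm E" 2]
      by (intro add_mono) auto
    finally show ?thesis by simp
  qed
  then have "\<forall>n. Q n \<in> span D \<inter> cball 0 3"
    using D by simp
  then obtain P r where r: "strict_mono (r :: nat \<Rightarrow> nat)" "(Q \<circ> r) \<longlonglongrightarrow> P"
    using compact_span_Int_cball[OF D(1), of 3] unfolding compact_def by metis
  show thesis
  proof (rule that)
    have "(\<lambda>n. (Q \<circ> r) n - id_blinfun - E) \<longlonglongrightarrow> P - id_blinfun - E"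
      using r(2) by (intro tendsto_intros)
    then have "(\<lambda>n. norm ((Q \<circ> r) n - id_blinfun - E)) \<longlonglongrightarrow> norm (P - id_blinfun - E)"
      by (rule tendsto_norm)
    then show "norm (P - id_blinfun - E) \<le> (norm E)\<^sup>2"
      by (rule LIMSEQ_le_const2) (auto simp: first)
  next
    fix x y :: 'g
    let ?M = "norm b * (norm E)\<^sup>2 * norm x * norm y * (exp (norm E))\<^sup>2"
    let ?F = "\<lambda>n. (Q \<circ> r) n (b x y) - b ((Q \<circ> r) n x) ((Q \<circ> r) n y)"
    have "(\<lambda>n. ?M * (1 / real (Suc n))) \<longlonglongrightarrow> ?M * 0"
      using LIMSEQ_inverse_real_of_nat by (intro tendsto_mult_left) (simp add: inverse_eq_divide)
    then have "((\<lambda>n. ?M * (1 / real (Suc n))) \<circ> r) \<longlonglongrightarrow> 0"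
      using LIMSEQ_subseq_LIMSEQ[OF _ r(1)] by simp
    then have "?F \<longlonglongrightarrow> 0"
      by (rule Lim_null_comparison[rotated])
        (unfold o_def, intro always_eventually allI defect)
    moreover have "?F \<longlonglongrightarrow> P (b x y) - b (P x) (P y)"
      using r(2) by (intro tendsto_intros)
    ultimately show "P (b x y) = b (P x) (P y)"
      using LIMSEQ_unique by fastforce
  qed
qed

section \<open>Cocycles in degree one\<close>

lemma ce_diff_1:
  "ce_diff br r \<omega> [x, y] = r x (\<omega> [y]) - r y (\<omega> [x]) - \<omega> [br x y]"
  by (simp add: ce_diff_def nths_Cons lessThan_Suc)

lemma ce_diff_0: "ce_diff br r \<omega> [x] = r x (\<omega> [])"
  by (simp add: ce_diff_def)

text \<open>Being a cocycle is a condition on lists of every length. Both sums in the differential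
  evaluate \<omega> on lists one entry shorter than \<open>us\<close>, where it takes its default
  value zero.\<close>

lemma ce_diff_degree:
  assumes "\<omega> \<in> cochains k" "length us \<noteq> Suc k" "\<And>x. r x 0 = 0"
  shows "ce_diff br r \<omega> us = 0"
proof -
  have 1: "\<omega> (nths us (- {i})) = 0" if "i < length us" for i
  proof -
    have "{j. j < length us \<and> j \<in> - {i}} = {..<length us} - {i}"
      by auto
    then have "length (nths us (- {i})) = length us - 1"
      using that by (simp add: length_nths)
    then show ?thesis
      using assms(1,2) that by (auto simp: cochains_def)
  qed
  have 2: "\<omega> (u # nths us (- {i, j})) = 0" if "i < j" "j < length us" for i j u
  proof -
    have "{l. l < length us \<and> l \<in> - {i, j}} = {..<length us} - {i, j}"
      by auto
    then have "length (nths us (- {i, j})) = length us - 2"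
      using that by (simp add: length_nths card_Diff_subset)
    then show ?thesis
      using assms(1,2) that by (auto simp: cochains_def)
  qed
  show ?thesis
    unfolding ce_diff_def using assms(3) 1 2
    by (intro add_eq_0_iff[THEN iffD2]) (simp add: sum.neutral)
qed

lemma one_cocycleI:
  assumes "linear D" "\<And>x. linear (r x)" "\<And>x y. D (br x y) = r x (D y) - r y (D x)"
  shows "(\<lambda>us. if length us = 1 then D (hd us) else 0) \<in> cocycles br r 1" (is "?\<omega> \<in> _")
proof -
  have c: "?\<omega> \<in> cochains 1"
  proof -
    have "linear (\<lambda>u. ?\<omega> (us[i := u]))" if "length us = 1" "i < 1" for us :: "'a list" and i
    proof -
      have "(\<lambda>u. ?\<omega> (us[i := u])) = D"
        using that by (auto simp: fun_eq_iff length_Suc_conv)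
      then show ?thesis using assms(1) by simp
    qed
    then show ?thesis unfolding cochains_def by auto
  qed
  have "ce_diff br r ?\<omega> us = 0" for us
  proof (cases "length us = 2")
    case True
    then obtain x y where "us = [x, y]"
      by (auto simp: numeral_2_eq_2 length_Suc_conv)
    then show ?thesis by (simp add: ce_diff_1 assms(3))
  next
    case False
    then show ?thesis
      using ce_diff_degree[OF c, of us r] assms(2) by (simp add: linear_0)
  qed
  with c show ?thesis by (auto simp: cocycles_def)
qed

lemma one_cocycleD:
  assumes "\<omega> \<in> cocycles br r 1"
  shows "linear (\<lambda>u. \<omega> [u])" "\<omega> [br x y] = r x (\<omega> [y]) - r y (\<omega> [x])"
proof -
  \<comment> \<open>Linearity of cochains is phrased through list updates, so \<open>[0]\<close>
    serves as a template whose only entry is overwritten.\<close>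
  have "linear (\<lambda>u. \<omega> ([0][0 := u]))"
  proof -
    have "\<omega> \<in> cochains 1"
      using assms by (simp add: cocycles_def)
    then have "\<forall>us i. length us = 1 \<and> i < 1 \<longrightarrow> linear (\<lambda>u. \<omega> (us[i := u]))"
      unfolding cochains_def by simp
    from this[rule_format, of "[0]" 0] show ?thesis by simp
  qed
  then show "linear (\<lambda>u. \<omega> [u])" by simp
  have "ce_diff br r \<omega> [x, y] = 0"
    using assms by (simp add: cocycles_def)
  then show "\<omega> [br x y] = r x (\<omega> [y]) - r y (\<omega> [x])"
    by (simp add: ce_diff_1)
qed

text \<open>A zero-cochain amounts to its value on the empty list, and this value is
  \<open>v\<close>.\<close>

lemma one_coboundaryD:
  assumes "\<omega> \<in> coboundaries br r 1"
  obtains v where "\<And>x. \<omega> [x] = r x v"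
proof -
  obtain \<theta> where "\<omega> = ce_diff br r \<theta>"
    using assms by (auto simp: coboundaries_def)
  then show thesis
    using that[of "\<theta> []"] by (simp add: ce_diff_0)
qed

lemma (in real_lie_algebra) linear_ad: "linear (ad bracket x)"
  using bilinear unfolding ad_def bilinear_def by simp

lemma (in real_lie_algebra) bracket_anti: "bracket x y = - bracket y x"
proof -
  have "bracket x y + bracket y x = 0"
    using bracket_self[of "x + y"] bracket_self[of x] bracket_self[of y]
    by (simp add: bilinear_ladd[OF bilinear] bilinear_radd[OF bilinear] add.commute)
  then show ?thesis
    by (simp only: eq_neg_iff_add_eq_0)
qed

text \<open>
  Coboundaries on \<open>\<hh>\<close> are pulled back from inner derivations of \<open>\<gg>\<close>, so surjectivity in
  cohomology already gives surjectivity on cocycles.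
\<close>

lemma derivation_along_hom_extends:
  assumes brg: "real_lie_algebra brg"
    and \<rho>: "lie_hom brh brg \<rho>"
    and surj: "cohomology_map brh (ad brg) 1 \<rho> ` cohomology brg (ad brg) 1
           = cohomology brh (ad brg \<circ> \<rho>) 1"
    and D: "linear D" "\<And>x y. D (brh x y) = brg (\<rho> x) (D y) - brg (\<rho> y) (D x)"
  obtains E where "linear E" "\<And>x y. E (brg x y) = brg (E x) y + brg x (E y)"
    "\<And>x. D x = E (\<rho> x)"
proof -
  interpret real_lie_algebra brg by fact
  let ?\<omega> = "\<lambda>us. if length us = 1 then D (hd us) else 0"
  have \<omega>: "?\<omega> \<in> cocycles brh (ad brg \<circ> \<rho>) 1"
    by (rule one_cocycleI) (use D linear_ad in \<open>auto simp: ad_def\<close>)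
  have eq: "equiv (cocycles brh (ad brg \<circ> \<rho>) 1) (cohomologous brh (ad brg \<circ> \<rho>) 1)"
    by (rule equiv_cohomologous) (simp add: linear_ad)
  have "cohomologous brh (ad brg \<circ> \<rho>) 1 `` {?\<omega>} \<in> cohomology brh (ad brg \<circ> \<rho>) 1"
    unfolding cohomology_def using \<omega> by (rule quotientI)
  then obtain c where c: "c \<in> cohomology brg (ad brg) 1"
    "cohomologous brh (ad brg \<circ> \<rho>) 1 `` {?\<omega>} = cohomology_map brh (ad brg) 1 \<rho> c"
    unfolding surj[symmetric] by (rule imageE)
  then obtain \<eta> where \<eta>: "\<eta> \<in> cocycles brg (ad brg) 1"
    and c_eq: "c = cohomologous brg (ad brg) 1 `` {\<eta>}"
    unfolding cohomology_def by (elim quotientE)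
  have \<eta>_class: "cohomologous brh (ad brg \<circ> \<rho>) 1 `` {?\<omega>} =
      cohomologous brh (ad brg \<circ> \<rho>) 1 `` {pullback \<rho> \<eta>}"
    unfolding c(2) c_eq by (rule cohomology_map_class[OF linear_ad \<rho> \<eta>])
  have "(?\<omega>, pullback \<rho> \<eta>) \<in> cohomologous brh (ad brg \<circ> \<rho>) 1"
    using eq_equiv_class[OF \<eta>_class eq pullback_cocycle[OF \<rho> \<eta>]] .
  then have "(\<lambda>us. ?\<omega> us - pullback \<rho> \<eta> us) \<in> coboundaries brh (ad brg \<circ> \<rho>) 1"
    by (simp add: cohomologous_def)
  then obtain v where v: "\<And>x. ?\<omega> [x] - pullback \<rho> \<eta> [x] = (ad brg \<circ> \<rho>) x v"
    by (rule one_coboundaryD) blast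
  note \<eta>1 = one_cocycleD[OF \<eta>]
  show thesis
  \<comment> \<open>The class of \<omega> is hit by that of \<eta>, so the two differ along \<rho>
    by the coboundary of \<open>v\<close>. Adding the inner derivation \<open>brg y v\<close>
    removes this difference.\<close>
  proof (rule that[of "\<lambda>y. \<eta> [y] + brg y v"])
    show "linear (\<lambda>y. \<eta> [y] + brg y v)"
      using \<eta>1(1) bilinear unfolding bilinear_def by (simp add: linear_compose_add)
    show "D x = \<eta> [\<rho> x] + brg (\<rho> x) v" for x
      using v[of x] by (simp add: pullback_def ad_def algebra_simps)
    \<comment> \<open>By antisymmetry the cocycle equation for \<eta> is the Leibniz rule; the
      Jacobi identity supplies it for the inner part.\<close>
    show "\<eta> [brg x y] + brg (brg x y) v = brg (\<eta> [x] + brg x v) y + brg x (\<eta> [y] + brg y v)" for x y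
    proof -
      have "brg (brg x y) v = - brg v (brg x y)" "brg y (\<eta> [x]) = - brg (\<eta> [x]) y"
        "brg (brg x v) y = - brg y (brg x v)" "brg y (brg x v) = - brg y (brg v x)"
        using bracket_anti[of "brg x y" v] bracket_anti[of y "\<eta> [x]"] bracket_anti[of "brg x v" y]
          bracket_anti[of x v] bilinear_rneg[OF bilinear, of y "brg v x"] by simp_all
      then show ?thesis
        using \<eta>1(2)[of x y] jacobi[of x y v]
        by (simp add: ad_def bilinear_ladd[OF bilinear] bilinear_radd[OF bilinear] algebra_simps)
    qed
  qed
qed

section \<open>Rigidity\<close>

text \<open>The analytic core in terms of bounded brackets: \<open>derivation_extends\<close> is the
  form in which surjectivity on degree-one cohomology enters, with \<open>D\<close> a cocycle along
  \<rho> and \<open>E\<close> a derivation.\<close>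

locale infinitesimally_rigid_hom =
  fixes bh :: "'h::real_normed_vector \<Rightarrow>\<^sub>L 'h \<Rightarrow>\<^sub>L 'h"
    and bg :: "'g::real_normed_vector \<Rightarrow>\<^sub>L 'g \<Rightarrow>\<^sub>L 'g"
    and \<rho> :: "'h \<Rightarrow>\<^sub>L 'g" and BH :: "'h set" and BG :: "'g set"
  assumes fin_h: "finite BH" "span BH = UNIV" and fin_g: "finite BG" "span BG = UNIV"
    and hom: "\<rho> (bh x y) = bg (\<rho> x) (\<rho> y)"
    and derivation_extends: "(\<And>x y. blinfun_apply D (bh x y) = bg (D x) (\<rho> y) + bg (\<rho> x) (D y)) \<Longrightarrow>
      \<exists>E. (\<forall>x y. blinfun_apply E (bg x y) = bg (E x) y + bg x (E y)) \<and> D = E o\<^sub>L \<rho>"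
begin

text \<open>
  One step of a Newton iteration in \<open>Aut(\<gg>)\<close>.  The deviation \<open>d\<close> from \<open>\<rho>\<close> satisfies the cocycle
  condition up to the quadratic term \<open>[d x, d y]\<close>; correcting it to a cocycle \<open>E \<circ> \<rho>\<close> and applying
  an automorphism close to \<open>1 - E\<close> leaves a deviation of order \<open>\<parallel>d\<parallel>\<^sup>2\<close>.
\<close>

lemma newton_step:
  obtains \<delta> K\<^sub>1 K\<^sub>2 where "\<delta> > 0" "K\<^sub>1 \<ge> 0" "K\<^sub>2 \<ge> 0"
    "\<And>d. norm d \<le> \<delta> \<Longrightarrow> (\<And>x y. (\<rho> + d) (bh x y) = bg ((\<rho> + d) x) ((\<rho> + d) y)) \<Longrightarrow>
      \<exists>P. (\<forall>x y. blinfun_apply P (bg x y) = bg (P x) (P y)) \<and> norm (P - id_blinfun) \<le> K\<^sub>1 * norm d \<and>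
          norm ((P o\<^sub>L (\<rho> + d)) - \<rho>) \<le> K\<^sub>2 * (norm d)\<^sup>2"
proof -
  have "\<exists>b. \<forall>x y. blinfun_apply (blinfun_apply b x) y
      = d (bh x y) - bg (d x) (\<rho> y) - bg (\<rho> x) (d y)" for d :: "'h \<Rightarrow>\<^sub>L 'g"
  proof -
    have "bilinear (\<lambda>x y. d (bh x y) - bg (d x) (\<rho> y) - bg (\<rho> x) (d y))"
      unfolding bilinear_def by (intro conjI allI linearI)
        (simp_all add: blinfun.bilinear_simps algebra_simps)
    then show ?thesis
      by (rule bilinear_blinfunE[OF _ fin_h fin_h]) blast
  qed
  \<comment> \<open>\<open>L\<close> is the linearised homomorphism equation at \<rho>, the negative
    of the differential on one-cochains when \<open>bg\<close> is antisymmetric; its kernel is the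
    space of cocycles along \<rho>.\<close>
  then obtain L :: "('h \<Rightarrow>\<^sub>L 'g) \<Rightarrow> 'h \<Rightarrow>\<^sub>L 'h \<Rightarrow>\<^sub>L 'g"
    where L: "\<And>d x y. L d x y = d (bh x y) - bg (d x) (\<rho> y) - bg (\<rho> x) (d y)"
    by metis
  have linL: "linear L"
    by (intro linearI blinfun_eqI) (simp_all add: L blinfun.bilinear_simps algebra_simps)
  obtain X :: "('h \<Rightarrow>\<^sub>L 'g) set" where X: "finite X" "span X = UNIV"
    by (rule finite_span_blinfun[OF fin_h fin_g])
  obtain K where K: "K \<ge> 0" "\<And>d. \<exists>d'. L d' = L d \<and> norm d' \<le> K * norm (L d)"
    using linear_bounded_lift[OF linL X(1), of UNIV] X(2) by auto
  define Der where "Der = {E :: 'g \<Rightarrow>\<^sub>L 'g. \<forall>x y. E (bg x y) = bg (E x) y + bg x (E y)}"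
  obtain Y :: "('g \<Rightarrow>\<^sub>L 'g) set" where Y: "finite Y" "span Y = UNIV"
    by (rule finite_span_blinfun[OF fin_g fin_g])
  have "subspace Der"
    unfolding Der_def by (intro subspaceI) (auto simp: blinfun.bilinear_simps algebra_simps)
  moreover have "linear (\<lambda>E. E o\<^sub>L \<rho>)"
    by (intro linearI blinfun_eqI) (simp_all add: blinfun.bilinear_simps)
  ultimately obtain R where R: "R \<ge> 0"
    "\<And>E. E \<in> Der \<Longrightarrow> \<exists>E'\<in>Der. E' o\<^sub>L \<rho> = E o\<^sub>L \<rho> \<and> norm E' \<le> R * norm (E o\<^sub>L \<rho>)"
    using linear_bounded_lift[of "\<lambda>E. E o\<^sub>L \<rho>" Y Der] Y by auto
  define M where "M = norm bg"
  have M: "M \<ge> 0" by (simp add: M_def)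
  \<comment> \<open>Makes three quantities at most one: \<open>norm d\<close>, so that \<rho> +
    \<open>d\<close> stays bounded; \<open>K * M * norm d\<close>, so that the correction is no
    larger than \<open>d\<close>; and \<open>2 * R * norm d\<close>, so that
    \<open>norm E \<le> 1\<close>.\<close>
  define \<delta> where "\<delta> = 1 / (1 + K * M + 2 * R)"
  define K\<^sub>2 where "K\<^sub>2 = 4 * R\<^sup>2 * (norm \<rho> + 1) + 2 * R + K * M"
  have pos: "1 + K * M + 2 * R > 0"
    using K(1) R(1) M by (simp add: add_pos_nonneg)
  show thesis
  proof (rule that[of \<delta> "4 * R" K\<^sub>2])
    show "\<delta> > 0" using pos by (simp add: \<delta>_def)
    show "4 * R \<ge> 0" "K\<^sub>2 \<ge> 0" using K(1) R(1) M by (simp_all add: K\<^sub>2_def)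
    fix d assume d: "norm d \<le> \<delta>"
      and hom_d: "\<And>x y. (\<rho> + d) (bh x y) = bg ((\<rho> + d) x) ((\<rho> + d) y)"
    have "norm d * (1 + K * M + 2 * R) \<le> 1"
      using d pos by (simp add: \<delta>_def pos_le_divide_eq)
    then have "norm d + K * M * norm d + 2 * R * norm d \<le> 1"
      by (simp add: algebra_simps)
    moreover have "0 \<le> K * M * norm d" "0 \<le> R * norm d"
      using K(1) R(1) M by auto
    ultimately have small: "norm d \<le> 1" "K * M * norm d \<le> 1" "2 * R * norm d \<le> 1"
      using norm_ge_zero[of d] by linarith+
    have "norm (L d) \<le> M * (norm d)\<^sup>2"
    proof (intro norm_blinfun_bound)
      fix x y
      \<comment> \<open>Subtracting the homomorphism equation of \<rho> from that of \<rho> +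
        \<open>d\<close> leaves the linear part equal to the quadratic one.\<close>
      have "L d x y = bg (d x) (d y)"
        using hom_d[of x y] by (simp add: L hom blinfun.bilinear_simps algebra_simps)
      also have "norm \<dots> \<le> norm (bg (d x)) * norm (d y)"
        by (rule norm_blinfun)
      also have "\<dots> \<le> (M * (norm d * norm x)) * (norm d * norm y)"
      proof (rule mult_mono)
        have "norm (bg (d x)) \<le> norm bg * norm (d x)" by (rule norm_blinfun)
        also have "\<dots> \<le> norm bg * (norm d * norm x)"
          by (intro mult_left_mono norm_blinfun norm_ge_zero)
        finally show "norm (bg (d x)) \<le> M * (norm d * norm x)"
          by (simp add: M_def)
      qed (auto simp: norm_blinfun M)
      finally show "norm (L d x y) \<le> M * (norm d)\<^sup>2 * norm x * norm y"
        by (simp add: power2_eq_square mult_ac)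
    qed (use M in auto)
    then have KLd: "K * norm (L d) \<le> K * (M * (norm d)\<^sup>2)"
      using K(1) by (rule mult_left_mono)
    obtain d' where d': "L d' = L d" "norm d' \<le> K * norm (L d)"
      using K(2) by blast
    have nd': "norm d' \<le> K * M * (norm d)\<^sup>2"
      using d'(2) KLd by (simp add: mult.assoc)
    also have "\<dots> = (K * M * norm d) * norm d"
      by (simp add: power2_eq_square)
    also have "\<dots> \<le> 1 * norm d"
      by (intro mult_right_mono small norm_ge_zero)
    finally have nz: "norm (d - d') \<le> 2 * norm d"
      using norm_triangle_ineq4[of d d'] by simp
    have "L (d - d') = 0"
      using linL d'(1) by (simp add: linear_diff)
    then have "L (d - d') x y = 0" for x y
      by simp
    then have "(d - d') (bh x y) = bg ((d - d') x) (\<rho> y) + bg (\<rho> x) ((d - d') y)" for x y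
      unfolding L by (simp add: algebra_simps)
    then obtain E\<^sub>0 where "E\<^sub>0 \<in> Der" "d - d' = E\<^sub>0 o\<^sub>L \<rho>"
      using derivation_extends[of "d - d'"] unfolding Der_def by auto
    then obtain E where E: "E \<in> Der" "E o\<^sub>L \<rho> = d - d'" "norm E \<le> R * norm (d - d')"
      using R(2)[of E\<^sub>0] by auto
    have nE: "norm E \<le> 2 * R * norm d"
      using order_trans[OF E(3) mult_left_mono[OF nz R(1)]] by simp
    with small have E1: "norm E \<le> 1" by simp
    obtain P where P: "\<And>x y. blinfun_apply P (bg x y) = bg (P x) (P y)"
      "norm (P - id_blinfun - (- E)) \<le> (norm (- E))\<^sup>2"
    proof (rule derivation_approx_hom[OF fin_g, of "- E" bg])
      show "(- E) (bg x y) = bg ((- E) x) y + bg x ((- E) y)" for x y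
        using E(1) by (simp add: Der_def blinfun.bilinear_simps)
    qed (use E1 in auto)
    let ?S = "P - id_blinfun + E"
    have S: "norm ?S \<le> (norm E)\<^sup>2"
      using P(2) by simp
    have EE: "(norm E)\<^sup>2 \<le> norm E"
      using E1 by (simp add: power2_eq_square mult_left_le)
    have "norm (P - id_blinfun) \<le> norm ?S + norm E"
      using norm_triangle_ineq4[of ?S E] by simp
    then have P1: "norm (P - id_blinfun) \<le> 4 * R * norm d"
      using S EE nE by simp
    \<comment> \<open>Write \<open>P = 1 - E + S\<close>. Since \<open>E\<close> composed with
      \<rho> is \<open>d - d'\<close>, the first-order term \<open>d\<close> cancels and every
      remaining term is quadratic in \<open>norm d\<close>.\<close>
    have "(P o\<^sub>L (\<rho> + d)) - \<rho> = (?S o\<^sub>L (\<rho> + d)) - (E o\<^sub>L d) + d'"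
    proof (rule blinfun_eqI)
      fix x
      have "E (\<rho> x) = d x - d' x"
        using arg_cong[OF E(2), of "\<lambda>f. blinfun_apply f x"] by (simp add: blinfun.bilinear_simps)
      then show "((P o\<^sub>L (\<rho> + d)) - \<rho>) x = ((?S o\<^sub>L (\<rho> + d)) - (E o\<^sub>L d) + d') x"
        by (simp add: blinfun.bilinear_simps algebra_simps)
    qed
    also have "norm \<dots> \<le> norm (?S o\<^sub>L (\<rho> + d)) + norm (E o\<^sub>L d) + norm d'"
      by (intro norm_triangle_mono norm_triangle_ineq4 order_refl)
    also have "\<dots> \<le> (2 * R * norm d)\<^sup>2 * (norm \<rho> + 1) + (2 * R * norm d) * norm d + K * M * (norm d)\<^sup>2"
    proof (intro add_mono nd')
      have "norm (\<rho> + d) \<le> norm \<rho> + 1"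
        using norm_triangle_ineq[of \<rho> d] small by simp
      moreover have "norm ?S \<le> (2 * R * norm d)\<^sup>2"
        using S power_mono[OF nE, of 2] by simp
      ultimately show "norm (?S o\<^sub>L (\<rho> + d)) \<le> (2 * R * norm d)\<^sup>2 * (norm \<rho> + 1)"
        by (intro order_trans[OF norm_blinfun_compose] mult_mono) auto
      show "norm (E o\<^sub>L d) \<le> (2 * R * norm d) * norm d"
        by (intro order_trans[OF norm_blinfun_compose] mult_right_mono nE) auto
    qed
    also have "\<dots> = K\<^sub>2 * (norm d)\<^sup>2"
      by (simp add: K\<^sub>2_def power2_eq_square algebra_simps)
    finally show "\<exists>P. (\<forall>x y. blinfun_apply P (bg x y) = bg (P x) (P y)) \<and> norm (P - id_blinfun) \<le> 4 * R * norm d \<and>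
          norm ((P o\<^sub>L (\<rho> + d)) - \<rho>) \<le> K\<^sub>2 * (norm d)\<^sup>2"
      using P(1) P1 by blast
  qed
qed

text \<open>
  Instead of iterating \<open>newton_step\<close> we minimise \<open>\<parallel>A \<circ> \<phi> - \<rho>\<parallel> + t \<parallel>A - 1\<parallel>\<close> over a compact set of
  homomorphisms \<open>A\<close>.  The penalty term keeps the minimiser near \<open>1\<close>, hence in the interior, and
  for small \<open>t\<close> a Newton step would decrease the functional unless \<open>A \<circ> \<phi> = \<rho>\<close>.
\<close>

lemma carries_nearby_hom:
  assumes "\<epsilon> > 0"
  obtains \<delta> where "\<delta> > 0"
    "\<And>\<phi>. norm (\<phi> - \<rho>) < \<delta> \<Longrightarrow> (\<And>x y. \<phi> (bh x y) = bg (\<phi> x) (\<phi> y)) \<Longrightarrow>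
      \<exists>A. (\<forall>x y. blinfun_apply A (bg x y) = bg (A x) (A y)) \<and> norm (A - id_blinfun) \<le> 1/2 \<and>
          norm (A - id_blinfun) < \<epsilon> \<and> A o\<^sub>L \<phi> = \<rho>"
proof -
  obtain \<delta>\<^sub>0 K\<^sub>1 K\<^sub>2 where \<delta>\<^sub>0: "\<delta>\<^sub>0 > 0" and K: "K\<^sub>1 \<ge> 0" "K\<^sub>2 \<ge> 0" and step:
    "\<And>d. norm d \<le> \<delta>\<^sub>0 \<Longrightarrow> (\<And>x y. (\<rho> + d) (bh x y) = bg ((\<rho> + d) x) ((\<rho> + d) y)) \<Longrightarrow>
      \<exists>P. (\<forall>x y. blinfun_apply P (bg x y) = bg (P x) (P y)) \<and> norm (P - id_blinfun) \<le> K\<^sub>1 * norm d \<and>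
          norm ((P o\<^sub>L (\<rho> + d)) - \<rho>) \<le> K\<^sub>2 * (norm d)\<^sup>2"
    using newton_step by metis
  obtain D :: "('g \<Rightarrow>\<^sub>L 'g) set" where D: "finite D" "span D = UNIV"
    by (rule finite_span_blinfun[OF fin_g fin_g])
  \<comment> \<open>The radius 1/2 keeps the elements of \<open>N\<close> invertible by
    \<open>near_id_inverse\<close>.\<close>
  define N where "N = {A. \<forall>x y. blinfun_apply A (bg x y) = bg (A x) (A y)} \<inter> cball (id_blinfun :: 'g \<Rightarrow>\<^sub>L 'g) (1/2)"
  have "closed N"
    unfolding N_def Collect_all_eq
    by (intro closed_Int closed_INT ballI closed_Collect_eq continuous_intros closed_cball)
  moreover have "N \<subseteq> span D \<inter> cball 0 2"
  proof
    fix A assume "A \<in> N"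
    then have "norm (A - id_blinfun) \<le> 1/2"
      by (simp add: N_def dist_norm norm_minus_commute)
    then have "norm A \<le> 2"
      using norm_triangle_sub[of A id_blinfun] norm_blinfun_id_le[where 'a = 'g] by simp
    then show "A \<in> span D \<inter> cball 0 2" using D by simp
  qed
  ultimately have "compact N"
    using compact_Int_closed[OF compact_span_Int_cball[OF D(1), of 2]] by (metis Int_absorb1)
  \<comment> \<open>With this weight, a Newton step raises the penalty by at most half of
    \<open>norm d\<close>.\<close>
  define t where "t = 1 / (4 * K\<^sub>1 + 4)"
  have t: "t > 0" "t * (2 * K\<^sub>1) \<le> 1/2" and K1: "4 * K\<^sub>1 + 4 > 0"
    using K by (simp_all add: t_def field_simps)
  \<comment> \<open>In turn: the Newton step applies, it more than halves the deviation, the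
    improved competitor stays in \<open>N\<close>, and the minimiser is \<epsilon>-close to the
    identity.\<close>
  define \<delta> where "\<delta> = min (min \<delta>\<^sub>0 (1 / (2 * K\<^sub>2 + 2))) (min (1 / (12 * K\<^sub>1 + 8)) (\<epsilon> / (4 * K\<^sub>1 + 4)))"
  show thesis
  proof (rule that[of \<delta>])
    show "\<delta> > 0" using \<delta>\<^sub>0 K assms by (simp add: \<delta>_def add_nonneg_pos)
    fix \<phi> assume \<phi>: "norm (\<phi> - \<rho>) < \<delta>" and hom_\<phi>: "\<And>x y. \<phi> (bh x y) = bg (\<phi> x) (\<phi> y)"
    define \<eta> where "\<eta> = norm (\<phi> - \<rho>)"
    have \<eta>: "\<eta> \<ge> 0" "\<eta> \<le> \<delta>\<^sub>0" "K\<^sub>2 * \<eta> < 1/2" "(6 * K\<^sub>1 + 4) * \<eta> \<le> 1/2" "(4 * K\<^sub>1 + 4) * \<eta> < \<epsilon>"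
    proof -
      show "\<eta> \<ge> 0" by (simp add: \<eta>_def)
      show "\<eta> \<le> \<delta>\<^sub>0" using \<phi> by (simp add: \<eta>_def \<delta>_def)
      have "\<eta> < 1 / (2 * K\<^sub>2 + 2)" "\<eta> < 1 / (12 * K\<^sub>1 + 8)" "\<eta> < \<epsilon> / (4 * K\<^sub>1 + 4)"
        using \<phi> by (simp_all add: \<eta>_def \<delta>_def)
      then have "\<eta> * (2 * K\<^sub>2 + 2) < 1" "\<eta> * (12 * K\<^sub>1 + 8) < 1" "\<eta> * (4 * K\<^sub>1 + 4) < \<epsilon>"
        using K by (simp_all add: pos_less_divide_eq)
      then show "K\<^sub>2 * \<eta> < 1/2" "(6 * K\<^sub>1 + 4) * \<eta> \<le> 1/2" "(4 * K\<^sub>1 + 4) * \<eta> < \<epsilon>"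
        using \<open>\<eta> \<ge> 0\<close> by (simp_all add: algebra_simps)
    qed
    define J where "J A = norm ((A o\<^sub>L \<phi>) - \<rho>) + t * norm (A - id_blinfun)" for A
    have id_N: "id_blinfun \<in> N"
      by (simp add: N_def)
    have "continuous_on N J"
      unfolding J_def by (intro continuous_intros)
    with \<open>compact N\<close> id_N obtain A where A: "A \<in> N" "\<And>A'. A' \<in> N \<Longrightarrow> J A \<le> J A'"
      using continuous_attains_inf[of N J] by blast
    have hom_A: "A (bg x y) = bg (A x) (A y)" for x y
      using A(1) by (simp add: N_def)
    have A_near: "norm (A - id_blinfun) \<le> 1/2"
      using A(1) by (simp add: N_def dist_norm norm_minus_commute)
    define d where "d = (A o\<^sub>L \<phi>) - \<rho>"
    have id_\<phi>: "id_blinfun o\<^sub>L \<phi> = \<phi>"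
      by (rule blinfun_eqI) simp
    \<comment> \<open>Comparison with the identity, where \<open>J\<close> equals \<eta>, bounds
      both the remaining deviation and the distance of \<open>A\<close> from the identity.\<close>
    have JA: "norm d + t * norm (A - id_blinfun) \<le> \<eta>"
      using A(2)[OF id_N] unfolding J_def id_\<phi> by (simp add: d_def \<eta>_def)
    have d_le: "norm d \<le> \<eta>"
    proof -
      have "0 \<le> t * norm (A - id_blinfun)"
        using t(1) by simp
      with JA show ?thesis by linarith
    qed
    have "t * norm (A - id_blinfun) \<le> \<eta>"
      using JA norm_ge_zero[of d] by linarith
    then have A_le: "norm (A - id_blinfun) \<le> (4 * K\<^sub>1 + 4) * \<eta>"
      using K1 by (simp add: t_def pos_divide_le_eq mult.commute)
    \<comment> \<open>\<rho> + \<open>d\<close> is a composition of homomorphisms, so the Newton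
      step may be applied to it.\<close>
    have \<rho>d: "\<rho> + d = A o\<^sub>L \<phi>"
      by (simp add: d_def)
    obtain P where P: "\<And>x y. blinfun_apply P (bg x y) = bg (P x) (P y)" "norm (P - id_blinfun) \<le> K\<^sub>1 * norm d"
      "norm ((P o\<^sub>L (\<rho> + d)) - \<rho>) \<le> K\<^sub>2 * (norm d)\<^sup>2"
      using step[of d] d_le \<eta>(2) unfolding \<rho>d by (auto simp: hom_A hom_\<phi>)
    have "d = 0"
    proof (rule ccontr)
      assume "d \<noteq> 0"
      then have d0: "norm d > 0" by simp
      have "(P o\<^sub>L A) - id_blinfun = ((P - id_blinfun) o\<^sub>L A) + (A - id_blinfun)"
        by (rule blinfun_eqI) (simp add: blinfun.bilinear_simps)
      then have "norm ((P o\<^sub>L A) - id_blinfun) \<le> norm (P - id_blinfun) * norm A + norm (A - id_blinfun)"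
        by (metis norm_triangle_mono norm_blinfun_compose order_refl)
      also have "\<dots> \<le> (K\<^sub>1 * norm d) * 2 + norm (A - id_blinfun)"
      proof (intro add_right_mono mult_mono P(2))
        show "norm A \<le> 2"
          using norm_triangle_sub[of A id_blinfun] norm_blinfun_id_le[where 'a = 'g] A_near by simp
      qed (use K in auto)
      finally have PA: "norm ((P o\<^sub>L A) - id_blinfun) \<le> 2 * K\<^sub>1 * norm d + norm (A - id_blinfun)"
        by simp
      also have "\<dots> \<le> 2 * K\<^sub>1 * \<eta> + (4 * K\<^sub>1 + 4) * \<eta>"
        using K d_le A_le by (intro add_mono mult_left_mono) auto
      also have "\<dots> \<le> 1/2"
        using \<eta>(4) by (simp add: algebra_simps)
      finally have "P o\<^sub>L A \<in> N"
        using P(1) hom_A by (simp add: N_def dist_norm norm_minus_commute)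
      then have "J A \<le> J (P o\<^sub>L A)"
        by (rule A(2))
      moreover have "J (P o\<^sub>L A) < J A"
      proof -
        have "(P o\<^sub>L A) o\<^sub>L \<phi> = P o\<^sub>L (\<rho> + d)"
          unfolding \<rho>d by (rule blinfun_eqI) simp
        then have "norm (((P o\<^sub>L A) o\<^sub>L \<phi>) - \<rho>) \<le> (K\<^sub>2 * norm d) * norm d"
          using P(3) by (simp add: power2_eq_square)
        also have "\<dots> < 1/2 * norm d"
          using d0 mult_left_mono[OF d_le K(2)] \<eta>(3) by (intro mult_strict_right_mono) auto
        finally have "norm (((P o\<^sub>L A) o\<^sub>L \<phi>) - \<rho>) < 1/2 * norm d" .
        moreover have "t * norm ((P o\<^sub>L A) - id_blinfun) \<le> t * (2 * K\<^sub>1) * norm d + t * norm (A - id_blinfun)"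
          using mult_left_mono[OF PA, of t] t(1) by (simp add: algebra_simps)
        moreover have "t * (2 * K\<^sub>1) * norm d \<le> 1/2 * norm d"
          using t(2) by (rule mult_right_mono) simp
        ultimately show ?thesis
          unfolding J_def d_def[symmetric] by linarith
      qed
      ultimately show False by simp
    qed
    then have "A o\<^sub>L \<phi> = \<rho>"
      by (simp add: d_def)
    moreover have "norm (A - id_blinfun) < \<epsilon>"
      using A_le \<eta>(5) by simp
    ultimately show "\<exists>A. (\<forall>x y. blinfun_apply A (bg x y) = bg (A x) (A y)) \<and> norm (A - id_blinfun) \<le> 1/2 \<and>
          norm (A - id_blinfun) < \<epsilon> \<and> A o\<^sub>L \<phi> = \<rho>"
      using hom_A A_near by blast
  qed
qed

end

section \<open>Rigidity in terms of neighbourhoods of the identity\<close>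

theorem theorem5p10:
  fixes brh :: "'h::real_normed_vector \<Rightarrow> 'h \<Rightarrow> 'h"
    and brg :: "'g::real_normed_vector \<Rightarrow> 'g \<Rightarrow> 'g"
    and \<rho> :: "'h \<Rightarrow>\<^sub>L 'g"
  assumes "fin_dim_real_lie_algebra brh"
    and "fin_dim_real_lie_algebra brg"
    and "\<rho> \<in> Lie_Hom brh brg"
    and "cohomology_map brh (ad brg) 1 (blinfun_apply \<rho>) ` cohomology brg (ad brg) 1
           = cohomology brh (ad brg \<circ> blinfun_apply \<rho>) 1"
  shows "rigid_wrt_Aut brh brg \<rho>"
proof -
  interpret H: fin_dim_real_lie_algebra brh by fact
  interpret G: fin_dim_real_lie_algebra brg by fact
  have \<rho>: "lie_hom brh brg \<rho>"
    using assms(3) by (simp add: Lie_Hom_def)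
  obtain BH :: "'h set" and BG :: "'g set"
    where fin_h: "finite BH" "span BH = UNIV" and fin_g: "finite BG" "span BG = UNIV"
    using H.fin_dim G.fin_dim by blast
  obtain bh where bh: "\<And>x y. blinfun_apply (blinfun_apply bh x) y = brh x y"
    by (rule bilinear_blinfunE[OF H.bilinear fin_h fin_h]) blast
  obtain bg where bg: "\<And>x y. blinfun_apply (blinfun_apply bg x) y = brg x y"
    by (rule bilinear_blinfunE[OF G.bilinear fin_g fin_g]) blast
  have lin: "linear (blinfun_apply f)" for f :: "'x::real_normed_vector \<Rightarrow>\<^sub>L 'y::real_normed_vector"
    by (intro linearI) (simp_all add: blinfun.bilinear_simps)
  interpret infinitesimally_rigid_hom bh bg \<rho> BH BG
  proof
    show "\<rho> (bh x y) = bg (\<rho> x) (\<rho> y)" for x y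
      using \<rho> by (simp add: bh bg lie_hom_def)
    fix D :: "'h \<Rightarrow>\<^sub>L 'g"
    assume D: "\<And>x y. D (bh x y) = bg (D x) (\<rho> y) + bg (\<rho> x) (D y)"
    have D': "D (brh x y) = brg (\<rho> x) (D y) - brg (\<rho> y) (D x)" for x y
      using D[of x y] G.bracket_anti[of "D x" "\<rho> y"] by (simp add: bh bg)
    obtain E where E: "linear E" "\<And>x y. E (brg x y) = brg (E x) y + brg x (E y)" "\<And>x. D x = E (\<rho> x)"
      by (rule derivation_along_hom_extends[OF G.real_lie_algebra_axioms \<rho> assms(4) lin D']) blast
    have "blinfun_apply (Blinfun E) = E"
      using E(1) fin_g by (intro bounded_linear_Blinfun_apply linear_imp_bounded_linear)
    with E(2,3) show "\<exists>E. (\<forall>x y. blinfun_apply E (bg x y) = bg (E x) y + bg x (E y)) \<and> D = E o\<^sub>L \<rho>"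
      by (intro exI[of _ "Blinfun E"] conjI blinfun_eqI) (simp_all add: bg)
  qed (fact fin_h fin_g)+
  show ?thesis
    unfolding rigid_wrt_Aut_def
  proof (intro allI impI, elim conjE)
    fix V assume "openin (top_of_set (Lie_Aut brg)) V" and id: "id_blinfun \<in> V"
    then obtain T where T: "open T" "V = Lie_Aut brg \<inter> T"
      by (auto simp: openin_open)
    with id obtain e where e: "e > 0" "ball id_blinfun e \<subseteq> T"
      by (metis IntD2 openE)
    \<comment> \<open>Half the radius, because passing to the inverse automorphism may double the
      distance from the identity.\<close>
    then have "e / 2 > 0" by simp
    then obtain \<delta> where \<delta>: "\<delta> > 0"
      "\<And>\<phi>. norm (\<phi> - \<rho>) < \<delta> \<Longrightarrow> (\<And>x y. \<phi> (bh x y) = bg (\<phi> x) (\<phi> y)) \<Longrightarrow>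
      \<exists>A. (\<forall>x y. blinfun_apply A (bg x y) = bg (A x) (A y)) \<and> norm (A - id_blinfun) \<le> 1/2 \<and>
          norm (A - id_blinfun) < e / 2 \<and> A o\<^sub>L \<phi> = \<rho>"
      by (rule carries_nearby_hom) blast
    have "\<exists>A\<in>V. \<phi> = A o\<^sub>L \<rho>" if \<phi>: "\<phi> \<in> Lie_Hom brh brg \<inter> ball \<rho> \<delta>" for \<phi>
    proof -
      have "norm (\<phi> - \<rho>) < \<delta>" "\<And>x y. \<phi> (bh x y) = bg (\<phi> x) (\<phi> y)"
        using \<phi> by (simp_all add: dist_norm norm_minus_commute Lie_Hom_def lie_hom_def bh bg)
      from \<delta>(2)[OF this] obtain A where A: "\<And>x y. blinfun_apply A (bg x y) = bg (A x) (A y)"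
        "norm (A - id_blinfun) \<le> 1/2" "norm (A - id_blinfun) < e / 2" "A o\<^sub>L \<phi> = \<rho>"
        by blast
      \<comment> \<open>\<open>A\<close> carries \<phi> to \<rho>, whereas rigidity asks for the
        opposite direction.\<close>
      obtain A' where A': "A' o\<^sub>L A = id_blinfun" "A o\<^sub>L A' = id_blinfun"
        "norm (A' - id_blinfun) \<le> 2 * norm (A - id_blinfun)"
        by (rule near_id_inverse[OF fin_g A(2)])
      have A'A: "A' (A x) = x" and AA': "A (A' x) = x" for x
        using A'(1,2) by (metis blinfun_apply_blinfun_compose blinfun_apply_id_blinfun)+
      have "A' (brg x y) = brg (A' x) (A' y)" for x y
        using A'A[of "brg (A' x) (A' y)"] A(1)[of "A' x" "A' y"] by (simp add: bg AA')
      moreover have "bij A'"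
        using A'A AA' by (intro bijI') metis+
      ultimately have "A' \<in> Lie_Aut brg"
        by (simp add: Lie_Aut_def Lie_Hom_def lie_hom_def lin)
      moreover have "A' \<in> T"
        using A'(3) A(3) e(2) by (auto simp: dist_norm norm_minus_commute)
      moreover have "\<phi> = A' o\<^sub>L \<rho>"
        unfolding A(4)[symmetric] by (rule blinfun_eqI) (simp add: A'A)
      ultimately show ?thesis
        using T(2) by blast
    qed
    moreover have "openin (top_of_set (Lie_Hom brh brg)) (Lie_Hom brh brg \<inter> ball \<rho> \<delta>)"
      by (intro openin_open_Int open_ball)
    ultimately show "\<exists>U. openin (top_of_set (Lie_Hom brh brg)) U \<and> \<rho> \<in> U \<and> (\<forall>\<rho>'\<in>U. \<exists>A\<in>V. \<rho>' = A o\<^sub>L \<rho>)"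
      using assms(3) \<delta>(1) by (intro exI[of _ "Lie_Hom brh brg \<inter> ball \<rho> \<delta>"]) auto
  qed
qed

end
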